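(* Let $G=S_4$ act on a complex abelian variety $A$. Let $H=\langle(34),(243)\rangle\cong S_3$, and let $V$ be the standard $3$-dimensional irreducible representation of $S_4$. Put $q_2=\frac16\sum_{y\in S_4\setminus H}y$. Then $$A_{H,\widetilde V}=\{z\in A_H:\ q_2(z)=-z\}_0=P(A_{H}/A_{S_4}).$$
   Context: The standard representation $V$ has character values $\chi_V(1)=3$, $\chi_V=1$ on transpositions, $-1$ on double transpositions, $0$ on $3$-cycles, and $-1$ on $4$-cycles. The action of $G$ induces $\mathbb{Q}[G]\to\mathrm{End}_\mathbb{Q}(A)$. For $\alpha\in\mathrm{End}_\mathbb{Q}(A)$, $\mathrm{Im}(\alpha):=\mathrm{Im}(n\alpha)$ for any positive integer $n$ with $n\alpha\in\mathrm{End}(A)$. For $K\le G$ set $p_K=\frac1{|K|}\sum_{k\in K}k$ and $A_K=\mathrm{Im}(p_K)$. Define $P(A_H/A_{S_4}):=\mathrm{Im}(p_H-p_{S_4})$, the complement of $A_{S_4}$ in $A_H$. Define $e_V:=\frac{3}{24}\sum_g\chi_V(g^{-1})g$ and $A_{H,\widetilde V}:=\mathrm{Im}(p_He_V)$. $\{\dots\}_0$ denotes the connected component containing $0$. *)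

theory Defs
  imports "HOL-Analysis.Analysis"
begin

section \<open>Complex tori C^n / Lambda and abelian varieties\<close>

text \<open>A complex abelian variety of dimension g = CARD('n) is, analytically, C^g / Lambda
 for a full lattice Lambda admitting a Riemann form (polarization).
 Lattice generated by real-linearly independent vectors b 0, ..., b (2g-1).\<close>

definition lattice_of :: "(nat \<Rightarrow> complex ^ 'n) \<Rightarrow> (complex ^ 'n) set" where
  "lattice_of b = {(\<Sum>i<2 * CARD('n). of_int (k i) *\<^sub>R b i) | k :: nat \<Rightarrow> int. True}"

definition full_lattice_basis :: "(nat \<Rightarrow> complex ^ 'n) \<Rightarrow> bool" where
  "full_lattice_basis b \<longleftrightarrow> inj_on b {..<2 * CARD('n)} \<and> independent (b ` {..<2 * CARD('n)})"

text \<open>Riemann form: real alternating form E, integral on the lattice, with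
 E(i x, i y) = E(x, y) and E(i x, x) > 0 for x \<noteq> 0.\<close>
definition riemann_form :: "(complex ^ 'n) set \<Rightarrow> (complex ^ 'n \<Rightarrow> complex ^ 'n \<Rightarrow> real) \<Rightarrow> bool" where
  "riemann_form L E \<longleftrightarrow>
     (\<forall>y. linear (\<lambda>x. E x y)) \<and> (\<forall>x y. E x y = - E y x) \<and>
     (\<forall>x y. E (\<i> *s x) (\<i> *s y) = E x y) \<and>
     (\<forall>x. x \<noteq> 0 \<longrightarrow> E (\<i> *s x) x > 0) \<and>
     (\<forall>l\<in>L. \<forall>m\<in>L. E l m \<in> \<int>)"

definition abelian_variety_lattice :: "(complex ^ 'n) set \<Rightarrow> bool" where
  "abelian_variety_lattice L \<longleftrightarrow>
     (\<exists>b. full_lattice_basis b \<and> L = lattice_of b) \<and> (\<exists>E. riemann_form L E)"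

text \<open>Points of A = C^n / L are the cosets x + L.\<close>
definition proj :: "(complex ^ 'n) set \<Rightarrow> complex ^ 'n \<Rightarrow> (complex ^ 'n) set" where
  "proj L x = (\<lambda>l. x + l) ` L"

text \<open>Quotient topology on A.\<close>
definition torus_top :: "(complex ^ 'n) set \<Rightarrow> (complex ^ 'n) set topology" where
  "torus_top L = topology (\<lambda>U. U \<subseteq> range (proj L) \<and> open (proj L -` U))"

lemma istopology_torus: "istopology (\<lambda>U. U \<subseteq> range (proj L) \<and> open (proj L -` U))"
  unfolding istopology_def
  by (auto simp: vimage_Union intro!: open_Union)

section \<open>The group S_4 and the action\<close>

definition S4 :: "(nat \<Rightarrow> nat) set" where
  "S4 = {p. p permutes {1..4}}"

text \<open>Subgroup generated by a set of permutations (closure under composition; finite group).\<close>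
inductive_set gen_perm :: "(nat \<Rightarrow> nat) set \<Rightarrow> (nat \<Rightarrow> nat) set" for S where
  gen_id: "id \<in> gen_perm S"
| gen_step: "s \<in> S \<Longrightarrow> p \<in> gen_perm S \<Longrightarrow> s \<circ> p \<in> gen_perm S"

definition tr34 :: "nat \<Rightarrow> nat" where
  "tr34 = (\<lambda>x. if x = 3 then 4 else if x = 4 then 3 else x)"

text \<open>The 3-cycle (2 4 3): 2 -> 4 -> 3 -> 2.\<close>
definition cyc243 :: "nat \<Rightarrow> nat" where
  "cyc243 = (\<lambda>x. if x = 2 then 4 else if x = 4 then 3 else if x = 3 then 2 else x)"

definition H_grp :: "(nat \<Rightarrow> nat) set" where
  "H_grp = gen_perm {tr34, cyc243}"

text \<open>Character of the standard representation: (number of fixed points) - 1.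
 This gives 3, 1, -1, 0, -1 on id, transpositions, double transpositions, 3-cycles, 4-cycles.\<close>
definition chiV :: "(nat \<Rightarrow> nat) \<Rightarrow> real" where
  "chiV g = real (card {i \<in> {1..4::nat}. g i = i}) - 1"

text \<open>An action of S_4 on A = C^n/L by automorphisms: complex matrices preserving L,
 multiplicative on S_4.\<close>
definition S4_action :: "(complex ^ 'n) set \<Rightarrow> ((nat \<Rightarrow> nat) \<Rightarrow> complex ^ 'n ^ 'n) \<Rightarrow> bool" where
  "S4_action L \<rho> \<longleftrightarrow> \<rho> id = mat 1 \<and>
     (\<forall>p\<in>S4. \<forall>q\<in>S4. \<rho> (p \<circ> q) = \<rho> p ** \<rho> q) \<and>
     (\<forall>p\<in>S4. \<forall>l\<in>L. \<rho> p *v l \<in> L)"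

text \<open>Image of the element sum_g c_g g of Q[G] in End_Q(A), as analytic representation.\<close>
definition grp_elt :: "((nat \<Rightarrow> nat) \<Rightarrow> complex ^ 'n ^ 'n) \<Rightarrow> ((nat \<Rightarrow> nat) \<Rightarrow> real) \<Rightarrow> complex ^ 'n ^ 'n" where
  "grp_elt \<rho> c = (\<Sum>g\<in>S4. c g *\<^sub>R \<rho> g)"

definition is_endo :: "(complex ^ 'n) set \<Rightarrow> complex ^ 'n ^ 'n \<Rightarrow> bool" where
  "is_endo L M \<longleftrightarrow> (\<forall>l\<in>L. M *v l \<in> L)"

text \<open>Im(alpha) := Im(n alpha) for a positive integer n with n alpha in End(A).\<close>
definition ImQ :: "(complex ^ 'n) set \<Rightarrow> complex ^ 'n ^ 'n \<Rightarrow> (complex ^ 'n) set set" where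
  "ImQ L M = (let n = (SOME n::nat. n > 0 \<and> is_endo L (real n *\<^sub>R M))
              in proj L ` range (\<lambda>x. (real n *\<^sub>R M) *v x))"

definition pK :: "((nat \<Rightarrow> nat) \<Rightarrow> complex ^ 'n ^ 'n) \<Rightarrow> (nat \<Rightarrow> nat) set \<Rightarrow> complex ^ 'n ^ 'n" where
  "pK \<rho> K = grp_elt \<rho> (\<lambda>g. if g \<in> K then 1 / real (card K) else 0)"

definition eV :: "((nat \<Rightarrow> nat) \<Rightarrow> complex ^ 'n ^ 'n) \<Rightarrow> complex ^ 'n ^ 'n" where
  "eV \<rho> = grp_elt \<rho> (\<lambda>g. 3 / 24 * chiV (inv g))"

definition q2 :: "((nat \<Rightarrow> nat) \<Rightarrow> complex ^ 'n ^ 'n) \<Rightarrow> complex ^ 'n ^ 'n" where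
  "q2 \<rho> = grp_elt \<rho> (\<lambda>g. if g \<notin> H_grp then 1 / 6 else 0)"

text \<open>{z in A_H : q2(z) = -z}: q2 acts on A_H via H-invariant lifts
 (well defined on A_H since q2 = sum over coset representatives of S4/H there).\<close>
definition q2_minus_set :: "(complex ^ 'n) set \<Rightarrow> ((nat \<Rightarrow> nat) \<Rightarrow> complex ^ 'n ^ 'n) \<Rightarrow> (complex ^ 'n) set set" where
  "q2_minus_set L \<rho> = {proj L x | x. x \<in> range (\<lambda>y. pK \<rho> H_grp *v y) \<and> q2 \<rho> *v x + x \<in> L}"

end

theory Submission
  imports Defs
begin

text \<open>
Let P = p_H - p_S4. As H is the stabiliser of 1 in S4, the sum of chi_V(h^-1 k) over h in H is
6 for k in H and -2 otherwise, and this gives p_H e_V = P; so both outer terms are the image of P.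
P is idempotent and 24 P is integral. On the H-invariant part q_2 acts as 4 p_S4 - 1, so every
point of {z in A_H : q_2 z = -z} has a lift x with 24 (x - P x) in the lattice. As the lattice is
discrete, a lift lying close to Im P + L lies in Im P + L. Hence the image of Im P is open and
closed in that set, and being connected and containing 0 it is the component of 0.
\<close>

section \<open>The symmetric group on four letters\<close>

definition perm4 :: "nat \<Rightarrow> nat \<Rightarrow> nat \<Rightarrow> nat \<Rightarrow> nat \<Rightarrow> nat" where
  "perm4 a b c d = (\<lambda>x. if x = 1 then a else if x = 2 then b else if x = 3 then c else if x = 4 then d else x)"

lemma perm4_apply [simp]:
  "perm4 a b c d 1 = a" "perm4 a b c d (Suc 0) = a" "perm4 a b c d 2 = b"
  "perm4 a b c d 3 = c" "perm4 a b c d 4 = d"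
  by (simp_all add: perm4_def)

lemma atLeastAtMost_1_4: "{1..4::nat} = {1,2,3,4}" by auto

lemma perm4_outside: "x \<notin> {1,2,3,4} \<Longrightarrow> perm4 a b c d x = x"
  by (auto simp: perm4_def)

lemma perm4_eqI:
  assumes "f 1 = a" "f 2 = b" "f 3 = c" "f 4 = d" "\<And>x. x \<notin> {1,2,3,4} \<Longrightarrow> f x = x"
  shows "f = perm4 a b c d"
proof
  fix x show "f x = perm4 a b c d x"
    using assms by (cases "x \<in> {1,2,3,4}") (auto simp: perm4_outside)
qed

lemma perm4_eq_iff [simp]: "perm4 a b c d = perm4 a' b' c' d' \<longleftrightarrow> a = a' \<and> b = b' \<and> c = c' \<and> d = d'"
  by (metis perm4_apply(1,3-5))

lemma perm4_comp:
  "perm4 a b c d \<circ> perm4 a' b' c' d' =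
     perm4 (perm4 a b c d a') (perm4 a b c d b') (perm4 a b c d c') (perm4 a b c d d')"
  by (rule perm4_eqI) (simp_all add: perm4_outside)

lemma perm4_comp':
  "(\<lambda>x. perm4 a b c d (perm4 a' b' c' d' x)) =
     perm4 (perm4 a b c d a') (perm4 a b c d b') (perm4 a b c d c') (perm4 a b c d d')"
  using perm4_comp by (simp add: comp_def)

lemma id_perm4: "id = perm4 1 2 3 4" by (rule perm4_eqI) auto

lemma tr34_perm4: "tr34 = perm4 1 2 4 3" by (rule perm4_eqI) (auto simp: tr34_def)

lemma cyc243_perm4: "cyc243 = perm4 1 4 2 3" by (rule perm4_eqI) (auto simp: cyc243_def)

lemma perm4_in_S4:
  assumes "distinct [a, b, c, d]" "{a, b, c, d} = {1..4}"
  shows "perm4 a b c d \<in> S4"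
  unfolding S4_def mem_Collect_eq atLeastAtMost_1_4
proof (rule bij_imp_permutes)
  have "inj_on (perm4 a b c d) {1,2,3,4}"
    using assms(1) unfolding inj_on_def by auto
  moreover have "perm4 a b c d ` {1,2,3,4} = {1,2,3,4}"
    using assms(2) unfolding atLeastAtMost_1_4 by simp
  ultimately show "bij_betw (perm4 a b c d) {1,2,3,4} {1,2,3,4}"
    by (simp add: bij_betw_def)
qed (rule perm4_outside)

lemma S4_eq: "S4 = {perm4 1 2 3 4, perm4 1 2 4 3, perm4 1 3 2 4, perm4 1 3 4 2, perm4 1 4 2 3,
    perm4 1 4 3 2, perm4 2 1 3 4, perm4 2 1 4 3, perm4 2 3 1 4, perm4 2 3 4 1, perm4 2 4 1 3,
    perm4 2 4 3 1, perm4 3 1 2 4, perm4 3 1 4 2, perm4 3 2 1 4, perm4 3 2 4 1, perm4 3 4 1 2,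
    perm4 3 4 2 1, perm4 4 1 2 3, perm4 4 1 3 2, perm4 4 2 1 3, perm4 4 2 3 1, perm4 4 3 1 2,
    perm4 4 3 2 1}" (is "_ = ?list")
proof
  show "?list \<subseteq> S4"
    by (intro insert_subsetI empty_subsetI perm4_in_S4) (auto simp: atLeastAtMost_1_4)
  show "S4 \<subseteq> ?list"
  proof
    fix p assume "p \<in> S4"
    then have p: "p permutes {1,2,3,4}" unfolding S4_def atLeastAtMost_1_4 by simp
    have p_eq: "p = perm4 (p 1) (p 2) (p 3) (p 4)"
      by (rule perm4_eqI) (simp_all add: permutes_not_in[OF p])
    have "p i \<in> {1,2,3,4}" if "i \<in> {1,2,3,4}" for i
      using permutes_in_image[OF p] that by blast
    then have "p 1 \<in> {1,2,3,4}" "p 2 \<in> {1,2,3,4}" "p 3 \<in> {1,2,3,4}" "p 4 \<in> {1,2,3,4}"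
      by simp_all
    moreover have "distinct [p 1, p 2, p 3, p 4]"
      using permutes_inj[OF p] by (simp add: inj_eq)
    ultimately show "p \<in> ?list"
      by (subst p_eq) (simp only: insert_iff empty_iff simp_thms; elim disjE; simp)
  qed
qed

lemma S4_cases:
  assumes "p \<in> S4"
  obtains "p = perm4 1 2 3 4" | "p = perm4 1 2 4 3" | "p = perm4 1 3 2 4" | "p = perm4 1 3 4 2"
   | "p = perm4 1 4 2 3" | "p = perm4 1 4 3 2" | "p = perm4 2 1 3 4" | "p = perm4 2 1 4 3"
   | "p = perm4 2 3 1 4" | "p = perm4 2 3 4 1" | "p = perm4 2 4 1 3" | "p = perm4 2 4 3 1"
   | "p = perm4 3 1 2 4" | "p = perm4 3 1 4 2" | "p = perm4 3 2 1 4" | "p = perm4 3 2 4 1"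
   | "p = perm4 3 4 1 2" | "p = perm4 3 4 2 1" | "p = perm4 4 1 2 3" | "p = perm4 4 1 3 2"
   | "p = perm4 4 2 1 3" | "p = perm4 4 2 3 1" | "p = perm4 4 3 1 2" | "p = perm4 4 3 2 1"
  using assms unfolding S4_eq by blast

lemma finite_S4: "finite S4"
  unfolding S4_def by (rule finite_permutations) simp

lemma card_S4: "card S4 = 24"
  unfolding S4_eq by simp

lemma S4_comp: "p \<in> S4 \<Longrightarrow> q \<in> S4 \<Longrightarrow> p \<circ> q \<in> S4"
  unfolding S4_def by (auto intro: permutes_compose)

lemma S4_inv: "p \<in> S4 \<Longrightarrow> inv p \<in> S4"
  unfolding S4_def by (auto intro: permutes_inv)

lemma S4_comp_inv_cancel: "p \<in> S4 \<Longrightarrow> p \<circ> (inv p \<circ> q) = q" "p \<in> S4 \<Longrightarrow> inv p \<circ> (p \<circ> q) = q"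
  unfolding S4_def by (auto simp: o_assoc permutes_inv_o)

lemma S4_subgroup: "g \<in> S4 \<Longrightarrow> h \<in> S4 \<Longrightarrow> inv g \<circ> h \<in> S4"
  by (simp add: S4_comp S4_inv)

lemma H_grp_eq: "H_grp = {perm4 1 2 3 4, perm4 1 2 4 3, perm4 1 3 2 4, perm4 1 3 4 2, perm4 1 4 2 3, perm4 1 4 3 2}"
  (is "_ = ?list")
proof
  show "H_grp \<subseteq> ?list"
  proof
    fix p assume "p \<in> H_grp"
    then show "p \<in> ?list" unfolding H_grp_def
      by induct (auto simp: id_perm4 tr34_perm4 cyc243_perm4 perm4_comp')
  qed
  have gens: "tr34 \<in> {tr34, cyc243}" "cyc243 \<in> {tr34, cyc243}" by simp_all
  note step = gen_perm.gen_step[OF gens(1)] gen_perm.gen_step[OF gens(2)] gen_perm.gen_id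
  have "id \<in> H_grp" "tr34 \<circ> id \<in> H_grp" "cyc243 \<circ> id \<in> H_grp"
    "cyc243 \<circ> (cyc243 \<circ> id) \<in> H_grp" "tr34 \<circ> (cyc243 \<circ> id) \<in> H_grp"
    "tr34 \<circ> (cyc243 \<circ> (cyc243 \<circ> id)) \<in> H_grp"
    unfolding H_grp_def by (intro step)+
  then show "?list \<subseteq> H_grp"
    by (simp add: id_perm4 tr34_perm4 cyc243_perm4 perm4_comp)
qed

lemma card_H_grp: "card H_grp = 6"
  by (simp add: H_grp_eq)

lemma H_grp_subset_S4: "H_grp \<subseteq> S4"
  unfolding H_grp_eq S4_eq by auto

lemma H_grp_nonempty: "H_grp \<noteq> {}"
  unfolding H_grp_def using gen_perm.gen_id by blast

lemma H_grp_stabilizer: "H_grp = {p \<in> S4. p 1 = 1}"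
proof
  show "H_grp \<subseteq> {p \<in> S4. p 1 = 1}"
    using H_grp_subset_S4 by (auto simp: H_grp_eq)
  show "{p \<in> S4. p 1 = 1} \<subseteq> H_grp"
  proof
    fix p assume "p \<in> {p \<in> S4. p 1 = 1}"
    then have "p \<in> S4" "p 1 = 1" by simp_all
    then show "p \<in> H_grp" by (elim S4_cases) (simp_all add: H_grp_eq)
  qed
qed

lemma H_grp_subgroup:
  assumes "g \<in> H_grp" "h \<in> H_grp"
  shows "inv g \<circ> h \<in> H_grp"
proof -
  have g: "g permutes {1..4}" "g 1 = 1" and h: "h \<in> S4" "h 1 = 1"
    using assms unfolding H_grp_stabilizer S4_def by simp_all
  have "inv g 1 = 1" using permutes_inv_eq[OF g(1)] g(2) by blast
  then show ?thesis
    unfolding H_grp_stabilizer using g h S4_comp S4_inv by (simp add: S4_def)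
qed

lemma chiV_inv:
  assumes "p \<in> S4"
  shows "chiV (inv p) = chiV p"
proof -
  have "inv p i = i \<longleftrightarrow> p i = i" for i
    using assms permutes_inv_eq unfolding S4_def by fastforce
  then show ?thesis unfolding chiV_def by simp
qed

lemma chiV_inv_comp:
  assumes "g \<in> S4"
  shows "chiV (inv g \<circ> k) =
    of_bool (k 1 = g 1) + of_bool (k 2 = g 2) + of_bool (k 3 = g 3) + of_bool (k 4 = g 4) - 1"
proof -
  have "inv g (k i) = i \<longleftrightarrow> k i = g i" for i
    using assms permutes_inv_eq unfolding S4_def by fastforce
  then have "{i \<in> {1..4}. (inv g \<circ> k) i = i} =
      {i. i = 1 \<and> k 1 = g 1} \<union> {i. i = 2 \<and> k 2 = g 2} \<union> {i. i = 3 \<and> k 3 = g 3} \<union> {i. i = 4 \<and> k 4 = g 4}"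
    unfolding atLeastAtMost_1_4 by auto
  then show ?thesis unfolding chiV_def by (simp add: card_Un_disjoint)
qed

lemma sum_chiV_H_coset:
  assumes "k \<in> S4"
  shows "(\<Sum>g\<in>H_grp. chiV (inv g \<circ> k)) = (if k \<in> H_grp then 6 else -2)"
  using assms H_grp_subset_S4 unfolding H_grp_eq
  by (elim S4_cases) (simp_all add: chiV_inv_comp)

section \<open>The group algebra acting by matrices\<close>

lemma matrix_mult_sum_left: "(A::'a::semiring_1^'n^'m) ** sum f S = (\<Sum>x\<in>S. A ** f x)"
  by (induct S rule: infinite_finite_induct) (auto simp: matrix_add_ldistrib)

lemma matrix_add_rdistrib: "((A::'a::semiring_1^'n^'m) + B) ** C = A ** C + B ** C"
  by (vector matrix_matrix_mult_def sum.distrib distrib_right)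

lemma matrix_mult_sum_right: "sum f S ** (A::'a::semiring_1^'n^'m) = (\<Sum>x\<in>S. f x ** A)"
  by (induct S rule: infinite_finite_induct) (auto simp: matrix_add_rdistrib)

lemma matrix_mult_diff_left: "(A::'a::ring_1^'n^'m) ** (B - C) = A ** B - A ** C"
  by (vector matrix_matrix_mult_def sum_subtractf right_diff_distrib)

lemma matrix_mult_diff_right: "((A::'a::ring_1^'n^'m) - B) ** C = A ** C - B ** C"
  by (vector matrix_matrix_mult_def sum_subtractf left_diff_distrib)

lemma matrix_mult_scaleR_left: "(c *\<^sub>R (A::'a::real_algebra_1^'n^'m)) ** B = c *\<^sub>R (A ** B)"
  by (vector matrix_matrix_mult_def scaleR_sum_right)

lemma matrix_mult_scaleR_right: "(A::'a::real_algebra_1^'n^'m) ** (c *\<^sub>R B) = c *\<^sub>R (A ** B)"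
  by (vector matrix_matrix_mult_def scaleR_sum_right)

lemma scaleR_matrix_vector_mult: "(c *\<^sub>R (A::'a::real_algebra_1^'n^'m)) *v x = c *\<^sub>R (A *v x)"
  by (vector matrix_vector_mult_def scaleR_sum_right)

lemma sum_matrix_vector_mult: "(sum f S :: 'a::semiring_1^'n^'m) *v x = (\<Sum>i\<in>S. f i *v x)"
  by (induct S rule: infinite_finite_induct) (auto simp: matrix_vector_mult_add_rdistrib)

lemma grp_elt_cong: "(\<And>g. g \<in> S4 \<Longrightarrow> c g = d g) \<Longrightarrow> grp_elt \<rho> c = grp_elt \<rho> d"
  unfolding grp_elt_def by (rule sum.cong) auto

lemma grp_elt_diff: "grp_elt \<rho> c - grp_elt \<rho> d = grp_elt \<rho> (\<lambda>g. c g - d g)"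
  unfolding grp_elt_def by (simp add: sum_subtractf scaleR_diff_left)

lemma grp_elt_scaleR: "a *\<^sub>R grp_elt \<rho> c = grp_elt \<rho> (\<lambda>g. a * c g)"
  unfolding grp_elt_def by (simp add: scaleR_sum_right)

lemma sum_scaleR_grp_elt:
  "finite X \<Longrightarrow> (\<Sum>x\<in>X. a x *\<^sub>R grp_elt \<rho> (f x)) = grp_elt \<rho> (\<lambda>g. \<Sum>x\<in>X. a x * f x g)"
  unfolding grp_elt_def
  by (simp add: scaleR_sum_right scaleR_sum_left sum.swap[of _ X] flip: scaleR_scaleR)

lemma sum_S4_indicator_mult:
  fixes f :: "(nat \<Rightarrow> nat) \<Rightarrow> real"
  assumes "K \<subseteq> S4"
  shows "(\<Sum>g\<in>S4. (if g \<in> K then a else 0) * f g) = a * (\<Sum>g\<in>K. f g)"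
proof -
  have "(\<Sum>g\<in>S4. (if g \<in> K then a else 0) * f g) = (\<Sum>g\<in>K. a * f g)"
    by (rule sum.mono_neutral_cong_right) (use assms finite_S4 in auto)
  then show ?thesis by (simp add: sum_distrib_left)
qed

lemma sum_pK_coefficients:
  assumes "K \<subseteq> S4" "K \<noteq> {}"
  shows "(\<Sum>g\<in>S4. if g \<in> K then 1 / real (card K) else 0) = 1"
proof -
  have "finite K" using assms(1) finite_S4 finite_subset by blast
  then show ?thesis
    using assms by (simp add: sum.If_cases finite_S4 Int_absorb1)
qed

lemma grp_elt_mult_invariant:
  assumes "\<And>g. g \<in> S4 \<Longrightarrow> c g \<noteq> 0 \<Longrightarrow> \<rho> g ** M = M"
  shows "grp_elt \<rho> c ** M = (\<Sum>g\<in>S4. c g) *\<^sub>R M"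
  unfolding grp_elt_def matrix_mult_sum_right matrix_mult_scaleR_left scaleR_sum_left
  using assms by (intro sum.cong) auto

lemma invariant_mult_grp_elt:
  assumes "\<And>g. g \<in> S4 \<Longrightarrow> c g \<noteq> 0 \<Longrightarrow> M ** \<rho> g = M"
  shows "M ** grp_elt \<rho> c = (\<Sum>g\<in>S4. c g) *\<^sub>R M"
  unfolding grp_elt_def matrix_mult_sum_left matrix_mult_scaleR_right scaleR_sum_left
  using assms by (intro sum.cong) auto

locale S4_rep =
  fixes \<rho> :: "(nat \<Rightarrow> nat) \<Rightarrow> complex ^ 'n ^ 'n"
  assumes rep_mult: "p \<in> S4 \<Longrightarrow> q \<in> S4 \<Longrightarrow> \<rho> (p \<circ> q) = \<rho> p ** \<rho> q"
begin

lemma mult_grp_elt: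
  assumes "g \<in> S4"
  shows "\<rho> g ** grp_elt \<rho> d = grp_elt \<rho> (\<lambda>k. d (inv g \<circ> k))"
proof -
  have "\<rho> g ** grp_elt \<rho> d = (\<Sum>h\<in>S4. d h *\<^sub>R \<rho> (g \<circ> h))"
    unfolding grp_elt_def matrix_mult_sum_left matrix_mult_scaleR_right
    by (rule sum.cong) (auto simp: rep_mult assms)
  also have "\<dots> = (\<Sum>k\<in>S4. d (inv g \<circ> k) *\<^sub>R \<rho> k)"
    by (rule sum.reindex_bij_witness[where i = "\<lambda>k. inv g \<circ> k" and j = "\<lambda>h. g \<circ> h"])
      (auto simp: assms S4_comp S4_inv S4_comp_inv_cancel)
  finally show ?thesis unfolding grp_elt_def .
qed

lemma grp_elt_mult:
  "grp_elt \<rho> c ** grp_elt \<rho> d = grp_elt \<rho> (\<lambda>k. \<Sum>g\<in>S4. c g * d (inv g \<circ> k))"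
proof -
  have "grp_elt \<rho> c ** grp_elt \<rho> d = (\<Sum>g\<in>S4. c g *\<^sub>R grp_elt \<rho> (\<lambda>k. d (inv g \<circ> k)))"
    unfolding grp_elt_def[of \<rho> c] matrix_mult_sum_right matrix_mult_scaleR_left
    by (rule sum.cong) (simp_all add: mult_grp_elt)
  also have "\<dots> = grp_elt \<rho> (\<lambda>k. \<Sum>g\<in>S4. c g * d (inv g \<circ> k))"
    by (rule sum_scaleR_grp_elt[OF finite_S4])
  finally show ?thesis .
qed

lemma pK_left_invariant:
  assumes K: "K \<subseteq> S4" "\<And>g h. g \<in> K \<Longrightarrow> h \<in> K \<Longrightarrow> inv g \<circ> h \<in> K" and g: "g \<in> K"
  shows "\<rho> g ** pK \<rho> K = pK \<rho> K"
proof -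
  have g_perm: "g permutes {1..4}" using K(1) g by (auto simp: S4_def)
  then have "id \<in> K" using K(2)[OF g g] by (simp add: permutes_inv_o)
  then have inv_g: "inv g \<in> K" using K(2)[OF g] by (metis comp_id)
  have "inv g \<circ> k \<in> K \<longleftrightarrow> k \<in> K" if "k \<in> S4" for k
  proof
    assume "inv g \<circ> k \<in> K"
    then have "inv (inv g) \<circ> (inv g \<circ> k) \<in> K" using K(2) inv_g by blast
    moreover have "g \<circ> (inv g \<circ> k) = k" using K(1) g by (blast intro: S4_comp_inv_cancel)
    ultimately show "k \<in> K" by (simp add: permutes_inv_inv[OF g_perm])
  qed (use K(2) g in blast)
  then show ?thesis
    unfolding pK_def using K(1) g by (subst mult_grp_elt) (auto intro: grp_elt_cong)
qed

lemma pK_S4_right_invariant: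
  assumes "h \<in> S4"
  shows "pK \<rho> S4 ** \<rho> h = pK \<rho> S4"
proof -
  have "pK \<rho> S4 ** \<rho> h = (\<Sum>g\<in>S4. (1 / 24) *\<^sub>R \<rho> (g \<circ> h))"
    unfolding pK_def grp_elt_def card_S4 matrix_mult_sum_right matrix_mult_scaleR_left
    by (rule sum.cong) (simp_all add: rep_mult assms)
  also have "\<dots> = (\<Sum>k\<in>S4. (1 / 24) *\<^sub>R \<rho> k)"
    by (rule sum.reindex_bij_witness[where i = "\<lambda>k. k \<circ> inv h" and j = "\<lambda>g. g \<circ> h"])
      (use assms in \<open>auto simp: S4_def o_assoc[symmetric] permutes_inv_o
          intro: permutes_compose permutes_inv\<close>)
  finally show ?thesis
    unfolding pK_def grp_elt_def card_S4 by simp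
qed

lemma pK_idem:
  assumes "K \<subseteq> S4" "\<And>g h. g \<in> K \<Longrightarrow> h \<in> K \<Longrightarrow> inv g \<circ> h \<in> K" "K \<noteq> {}"
  shows "pK \<rho> K ** pK \<rho> K = pK \<rho> K"
proof -
  have "pK \<rho> K ** pK \<rho> K = (\<Sum>g\<in>S4. if g \<in> K then 1 / real (card K) else 0) *\<^sub>R pK \<rho> K"
    by (subst (1) pK_def, rule grp_elt_mult_invariant)
      (auto simp: pK_left_invariant[OF assms(1,2)] split: if_splits)
  then show ?thesis using sum_pK_coefficients[OF assms(1,3)] by simp
qed

lemma pK_mult_pK_S4:
  assumes "K \<subseteq> S4" "K \<noteq> {}"
  shows "pK \<rho> K ** pK \<rho> S4 = pK \<rho> S4"
proof -
  have "pK \<rho> K ** pK \<rho> S4 = (\<Sum>g\<in>S4. if g \<in> K then 1 / real (card K) else 0) *\<^sub>R pK \<rho> S4"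
    by (subst (1) pK_def, rule grp_elt_mult_invariant) (simp add: pK_left_invariant S4_subgroup)
  then show ?thesis using sum_pK_coefficients[OF assms] by simp
qed

lemma pK_S4_mult_pK:
  assumes "K \<subseteq> S4" "K \<noteq> {}"
  shows "pK \<rho> S4 ** pK \<rho> K = pK \<rho> S4"
proof -
  have "pK \<rho> S4 ** pK \<rho> K = (\<Sum>g\<in>S4. if g \<in> K then 1 / real (card K) else 0) *\<^sub>R pK \<rho> S4"
    by (subst (2) pK_def, rule invariant_mult_grp_elt) (simp add: pK_S4_right_invariant)
  then show ?thesis using sum_pK_coefficients[OF assms] by simp
qed

lemma pK_H_idem: "pK \<rho> H_grp ** pK \<rho> H_grp = pK \<rho> H_grp"
  using H_grp_subset_S4 H_grp_subgroup H_grp_nonempty by (rule pK_idem)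

lemma pK_S4_idem: "pK \<rho> S4 ** pK \<rho> S4 = pK \<rho> S4"
  using S4_subgroup S4_eq by (intro pK_idem) auto

lemma pK_H_mult_complement:
  "pK \<rho> H_grp ** (pK \<rho> H_grp - pK \<rho> S4) = pK \<rho> H_grp - pK \<rho> S4"
  using H_grp_subset_S4 H_grp_nonempty by (simp add: matrix_mult_diff_left pK_H_idem pK_mult_pK_S4)

lemma pK_S4_mult_complement: "pK \<rho> S4 ** (pK \<rho> H_grp - pK \<rho> S4) = 0"
  using H_grp_subset_S4 H_grp_nonempty by (simp add: matrix_mult_diff_left pK_S4_idem pK_S4_mult_pK)

lemma complement_idem:
  "(pK \<rho> H_grp - pK \<rho> S4) ** (pK \<rho> H_grp - pK \<rho> S4) = pK \<rho> H_grp - pK \<rho> S4"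
  by (simp add: matrix_mult_diff_right pK_H_mult_complement pK_S4_mult_complement)

lemma pK_H_mult_eV: "pK \<rho> H_grp ** eV \<rho> = pK \<rho> H_grp - pK \<rho> S4"
proof -
  have eV: "eV \<rho> = grp_elt \<rho> (\<lambda>g. 1 / 8 * chiV g)"
    unfolding eV_def by (rule grp_elt_cong) (simp add: chiV_inv)
  have "pK \<rho> H_grp ** eV \<rho> =
      grp_elt \<rho> (\<lambda>k. \<Sum>g\<in>S4. (if g \<in> H_grp then 1 / 6 else 0) * (1 / 8 * chiV (inv g \<circ> k)))"
    unfolding eV pK_def card_H_grp grp_elt_mult by (simp only: of_nat_numeral)
  also have "\<dots> = grp_elt \<rho> (\<lambda>k. 1 / 6 * (\<Sum>g\<in>H_grp. 1 / 8 * chiV (inv g \<circ> k)))"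
    by (simp only: sum_S4_indicator_mult[OF H_grp_subset_S4])
  also have "\<dots> = grp_elt \<rho> (\<lambda>k. (if k \<in> H_grp then 1 / 6 else 0) - 1 / 24)"
    by (rule grp_elt_cong) (simp add: sum_chiV_H_coset flip: sum_divide_distrib)
  also have "\<dots> = pK \<rho> H_grp - pK \<rho> S4"
    unfolding pK_def card_H_grp card_S4 grp_elt_diff by (rule grp_elt_cong) simp
  finally show ?thesis .
qed

lemma q2_eq: "q2 \<rho> = 4 *\<^sub>R pK \<rho> S4 - pK \<rho> H_grp"
  unfolding q2_def pK_def card_H_grp card_S4 grp_elt_scaleR grp_elt_diff
  by (rule grp_elt_cong) simp

end

section \<open>Lattices and complex tori\<close>

lemma zero_in_lattice_of: "0 \<in> lattice_of b"
  unfolding lattice_of_def by (auto intro!: exI[of _ "\<lambda>_. 0"])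

lemma add_in_lattice_of:
  fixes x y :: "complex ^ 'n"
  assumes "x \<in> lattice_of b" "y \<in> lattice_of b"
  shows "x + y \<in> lattice_of b"
proof -
  obtain k k' where "x = (\<Sum>i<2 * CARD('n). of_int (k i) *\<^sub>R b i)"
      "y = (\<Sum>i<2 * CARD('n). of_int (k' i) *\<^sub>R b i)"
    using assms unfolding lattice_of_def by blast
  then have "x + y = (\<Sum>i<2 * CARD('n). of_int (k i + k' i) *\<^sub>R b i)"
    by (simp add: sum.distrib scaleR_add_left)
  then show ?thesis unfolding lattice_of_def by (intro CollectI exI[of _ "\<lambda>i. k i + k' i"]) simp
qed

lemma of_int_scaleR_in_lattice_of:
  fixes x :: "complex ^ 'n"
  assumes "x \<in> lattice_of b"
  shows "of_int z *\<^sub>R x \<in> lattice_of b"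
proof -
  obtain k where "x = (\<Sum>i<2 * CARD('n). of_int (k i) *\<^sub>R b i)"
    using assms unfolding lattice_of_def by blast
  then have "of_int z *\<^sub>R x = (\<Sum>i<2 * CARD('n). of_int (z * k i) *\<^sub>R b i)"
    by (simp add: scaleR_sum_right)
  then show ?thesis unfolding lattice_of_def by (intro CollectI exI[of _ "\<lambda>i. z * k i"]) simp
qed

lemma full_lattice_basis_coordinates:
  fixes b :: "nat \<Rightarrow> complex ^ 'n"
  assumes "full_lattice_basis b"
  obtains r where "\<And>j. bounded_linear (r j)"
    "\<And>j k. j < 2 * CARD('n) \<Longrightarrow> r j (\<Sum>i<2 * CARD('n). of_int (k i) *\<^sub>R b i) = real_of_int (k j)"
proof -
  define m where "m = 2 * CARD('n)"
  define B where "B = b ` {..<m}"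
  have inj: "inj_on b {..<m}" and indep: "independent B"
    using assms unfolding full_lattice_basis_def m_def B_def by auto
  have "card B = dim (UNIV :: (complex ^ 'n) set)"
    using inj by (simp add: B_def m_def card_image dim_UNIV)
  then have span: "span B = UNIV"
    using card_eq_dim[of B UNIV] indep by (auto simp: B_def)
  define r where "r j v = representation B v (b j)" for j v
  have lin: "bounded_linear (r j)" for j
    unfolding r_def by (rule bounded_linear_representation[OF indep span])
  have "r j (\<Sum>i<m. of_int (k i) *\<^sub>R b i) = of_int (k j)" if "j < m" for j k
  proof -
    have r_basis: "r j (b i) = (if i = j then 1 else 0)" if "i < m" for i
      using real_vector.representation_basis[OF indep, of "b i"] inj that \<open>j < m\<close>
      unfolding r_def B_def by (auto simp: inj_on_def)
    have "linear (r j)" using lin bounded_linear.linear by blast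
    then have "r j (\<Sum>i<m. of_int (k i) *\<^sub>R b i) = (\<Sum>i<m. of_int (k i) * r j (b i))"
      by (simp add: linear_sum linear_scale)
    also have "\<dots> = of_int (k j)"
      using that by (simp add: r_basis if_distrib cong: if_cong)
    finally show ?thesis .
  qed
  with lin show ?thesis using that unfolding m_def by blast
qed

lemma lattice_of_discrete:
  fixes b :: "nat \<Rightarrow> complex ^ 'n"
  assumes "full_lattice_basis b"
  obtains \<delta> where "\<delta> > 0" "\<And>l. l \<in> lattice_of b \<Longrightarrow> l \<noteq> 0 \<Longrightarrow> \<delta> \<le> norm l"
proof -
  define m where "m = 2 * CARD('n)"
  obtain r where lin: "\<And>j. bounded_linear (r j)"
    and coord: "\<And>j k. j < m \<Longrightarrow> r j (\<Sum>i<m. of_int (k i) *\<^sub>R b i) = real_of_int (k j)"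
    using full_lattice_basis_coordinates[OF assms] unfolding m_def by blast
  have "\<forall>j. \<exists>K>0. \<forall>v. norm (r j v) \<le> norm v * K"
    using lin bounded_linear.pos_bounded by blast
  then obtain K where K: "\<And>j. K j > 0" "\<And>j v. norm (r j v) \<le> norm v * K j"
    by metis
  define K_max where "K_max = (\<Sum>j<m. K j) + 1"
  have K_nonneg: "0 \<le> K j" for j using K(1) less_imp_le by blast
  have K_max: "K_max > 0" "\<And>j. j < m \<Longrightarrow> K j \<le> K_max"
    using sum_nonneg[of "{..<m}" K] member_le_sum[of _ "{..<m}" K] K_nonneg
    by (force simp: K_max_def)+
  show ?thesis
  proof
    show "1 / K_max > 0" using K_max by simp
    fix l assume "l \<in> lattice_of b" "l \<noteq> 0"
    then obtain k where l: "l = (\<Sum>i<m. of_int (k i) *\<^sub>R b i)"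
      unfolding lattice_of_def m_def by blast
    then obtain j where j: "j < m" "k j \<noteq> 0"
      using \<open>l \<noteq> 0\<close> by (metis (no_types, lifting) of_int_0 scale_zero_left sum.neutral lessThan_iff)
    have "1 \<le> \<bar>real_of_int (k j)\<bar>" using j(2) by linarith
    also have "\<dots> = norm (r j l)" using coord[OF j(1)] l by simp
    also have "\<dots> \<le> norm l * K_max"
      using K(2)[of j l] K_max(2)[OF j(1)] by (meson mult_left_mono norm_ge_zero order_trans)
    finally show "1 / K_max \<le> norm l" using K_max(1) by (simp add: field_simps)
  qed
qed

lemma openin_torus_top: "openin (torus_top L) U \<longleftrightarrow> U \<subseteq> range (proj L) \<and> open (proj L -` U)"
  unfolding torus_top_def topology_inverse'[OF istopology_torus] ..

lemma topspace_torus_top: "topspace (torus_top L) = range (proj L)"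
proof -
  have "proj L -` range (proj L) = UNIV" by blast
  then have "openin (torus_top L) (range (proj L))" unfolding openin_torus_top by simp
  then show ?thesis
    using openin_subset unfolding topspace_def openin_torus_top by blast
qed

lemma continuous_map_proj: "continuous_map euclidean (torus_top L) (proj L)"
  unfolding continuous_map topspace_torus_top by (auto simp: openin_torus_top vimage_def)

lemma connected_component_of_eq_clopen:
  assumes "openin X T" "closedin X T" "connectedin X T" "x \<in> T"
  shows "connected_component_of_set X x = T"
proof
  show "T \<subseteq> connected_component_of_set X x"
    using assms(3,4) by (rule connected_component_of_maximal)
  have "x \<in> connected_component_of_set X x"
    using assms(1,4) openin_subset connected_component_of_refl by fastforce
  then show "connected_component_of_set X x \<subseteq> T"
    using connectedin_clopen_cases[OF connectedin_connected_component_of assms(2,1)] assms(4)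
    by (auto simp: disjnt_iff)
qed

lemma range_scaleR_matrix_vector_mult:
  assumes "c \<noteq> 0"
  shows "range ((*v) (c *\<^sub>R (M :: 'a::real_algebra_1 ^ 'n ^ 'm))) = range ((*v) M)"
proof (intro equalityI image_subsetI)
  fix x
  have "(c *\<^sub>R M) *v x = M *v (c *\<^sub>R x)"
    by (simp add: scaleR_matrix_vector_mult linear_scale)
  then show "(c *\<^sub>R M) *v x \<in> range ((*v) M)" by simp
  have "M *v x = (c *\<^sub>R M) *v (x /\<^sub>R c)"
    using assms by (simp add: scaleR_matrix_vector_mult linear_scale)
  then show "M *v x \<in> range ((*v) (c *\<^sub>R M))" by simp
qed

lemma ImQ_eq_proj_range:
  assumes "n > 0" "is_endo L (real n *\<^sub>R M)"
  shows "ImQ L M = proj L ` range ((*v) M)"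
proof -
  define n' where "n' = (SOME n::nat. n > 0 \<and> is_endo L (real n *\<^sub>R M))"
  have "n' > 0" unfolding n'_def using someI[of "\<lambda>n. n > 0 \<and> is_endo L (real n *\<^sub>R M)"] assms by blast
  then show ?thesis
    unfolding ImQ_def Let_def n'_def[symmetric] by (simp add: range_scaleR_matrix_vector_mult)
qed

locale full_lattice =
  fixes L :: "(complex ^ 'n) set"
  assumes full_lattice: "\<exists>b. full_lattice_basis b \<and> L = lattice_of b"
begin

lemma lattice_zero: "0 \<in> L"
  using full_lattice zero_in_lattice_of by blast

lemma lattice_add: "x \<in> L \<Longrightarrow> y \<in> L \<Longrightarrow> x + y \<in> L"
  using full_lattice add_in_lattice_of by blast

lemma lattice_of_int_scaleR: "x \<in> L \<Longrightarrow> of_int z *\<^sub>R x \<in> L"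
  using full_lattice of_int_scaleR_in_lattice_of by blast

lemma lattice_of_nat_scaleR: "x \<in> L \<Longrightarrow> of_nat m *\<^sub>R x \<in> L"
  using lattice_of_int_scaleR[of x "int m"] by simp

lemma lattice_minus: "x \<in> L \<Longrightarrow> - x \<in> L"
  using lattice_of_int_scaleR[of x "-1"] by simp

lemma lattice_diff: "x \<in> L \<Longrightarrow> y \<in> L \<Longrightarrow> x - y \<in> L"
  using lattice_add[of x "- y"] lattice_minus[of y] by simp

lemma lattice_sum: "finite S \<Longrightarrow> (\<And>i. i \<in> S \<Longrightarrow> f i \<in> L) \<Longrightarrow> sum f S \<in> L"
  by (induct S rule: finite_induct) (auto intro: lattice_add lattice_zero)

lemma lattice_discrete:
  obtains \<delta> where "\<delta> > 0" "\<And>l. l \<in> L \<Longrightarrow> l \<noteq> 0 \<Longrightarrow> \<delta> \<le> norm l"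
  using full_lattice lattice_of_discrete by metis

lemma bounded_linear_lattice_values_near_0:
  fixes f :: "'a::real_normed_vector \<Rightarrow> complex ^ 'n"
  assumes "bounded_linear f"
  obtains \<epsilon> where "\<epsilon> > 0" "\<And>e. norm e < \<epsilon> \<Longrightarrow> f e \<in> L \<Longrightarrow> f e = 0"
proof -
  obtain \<delta> where \<delta>: "\<delta> > 0" "\<And>l. l \<in> L \<Longrightarrow> l \<noteq> 0 \<Longrightarrow> \<delta> \<le> norm l"
    using lattice_discrete by blast
  obtain K where K: "K > 0" "\<And>e. norm (f e) \<le> norm e * K"
    using bounded_linear.pos_bounded[OF assms] by blast
  show ?thesis
  proof
    show "\<delta> / K > 0" using \<delta>(1) K(1) by simp
    fix e assume "norm e < \<delta> / K" "f e \<in> L"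
    then have "norm (f e) < \<delta>"
      using K by (smt (verit, best) pos_less_divide_eq)
    then show "f e = 0" using \<delta>(2)[OF \<open>f e \<in> L\<close>] by fastforce
  qed
qed

lemma proj_eq_iff: "proj L x = proj L y \<longleftrightarrow> x - y \<in> L"
proof
  assume "proj L x = proj L y"
  moreover have "x \<in> proj L x" unfolding proj_def using lattice_zero by force
  ultimately obtain l where "l \<in> L" "x = y + l" unfolding proj_def by auto
  then show "x - y \<in> L" by simp
next
  assume xy: "x - y \<in> L"
  have "(\<lambda>l. x + l) ` L = (\<lambda>l. y + l) ` L"
  proof (intro equalityI image_subsetI)
    fix l assume "l \<in> L"
    show "x + l \<in> (\<lambda>l. y + l) ` L"
      by (rule image_eqI[of _ _ "(x - y) + l"]) (simp_all add: lattice_add xy \<open>l \<in> L\<close>)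
    show "y + l \<in> (\<lambda>l. x + l) ` L"
      using lattice_add[OF lattice_minus[OF xy] \<open>l \<in> L\<close>]
      by (intro image_eqI[of _ _ "- (x - y) + l"]) simp_all
  qed
  then show "proj L x = proj L y" unfolding proj_def .
qed

lemma openin_proj_image:
  assumes "open A"
  shows "openin (torus_top L) (proj L ` A)"
proof -
  have "proj L -` proj L ` A = (\<Union>l\<in>L. (\<lambda>a. l + a) ` A)"
  proof (intro equalityI subsetI)
    fix x assume "x \<in> proj L -` proj L ` A"
    then obtain a where "a \<in> A" "x - a \<in> L" by (auto simp: proj_eq_iff)
    moreover have "x = (x - a) + a" by simp
    ultimately show "x \<in> (\<Union>l\<in>L. (\<lambda>a. l + a) ` A)" by blast
  next
    fix x assume "x \<in> (\<Union>l\<in>L. (\<lambda>a. l + a) ` A)"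
    then obtain l a where "l \<in> L" "a \<in> A" "x = l + a" by blast
    then have "proj L x = proj L a" by (simp add: proj_eq_iff)
    then show "x \<in> proj L -` proj L ` A" using \<open>a \<in> A\<close> by simp
  qed
  moreover have "open (\<Union>l\<in>L. (\<lambda>a. l + a) ` A)"
    by (intro open_UN ballI open_translation assms)
  ultimately show ?thesis unfolding openin_torus_top by auto
qed

lemma idempotent_lattice_gap:
  fixes P :: "complex ^ 'n ^ 'n" and m :: nat
  assumes idem: "P ** P = P" and m: "m > 0"
    and P_lattice: "\<And>l. l \<in> L \<Longrightarrow> of_nat m *\<^sub>R (P *v l) \<in> L"
    and X_lattice: "\<And>x. x \<in> X \<Longrightarrow> of_nat m *\<^sub>R (x - P *v x) \<in> L"
  obtains \<epsilon> where "\<epsilon> > 0"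
    "\<And>x w l e. x \<in> X \<Longrightarrow> w \<in> range ((*v) P) \<Longrightarrow> l \<in> L \<Longrightarrow> norm e < \<epsilon> \<Longrightarrow>
      x = w + l + e \<Longrightarrow> proj L x \<in> proj L ` range ((*v) P)"
proof -
  define N where "N v = of_nat m *\<^sub>R (v - P *v v)" for v
  \<comment> \<open>N vanishes on the range of P and maps L and X into L, so by discreteness it is zero on small
    vectors whose value lies in L.\<close>
  have N_add: "N (u + v) = N u + N v" for u v
    by (simp add: N_def matrix_vector_right_distrib algebra_simps)
  have N_range: "N (P *v y) = 0" for y
    by (simp add: N_def matrix_vector_mul_assoc idem)
  have N_lattice: "N l \<in> L" if "l \<in> L" for l
    unfolding N_def scaleR_diff_right using lattice_diff lattice_of_nat_scaleR P_lattice that by blast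
  have "bounded_linear N"
    unfolding N_def by (intro bounded_linear_intros matrix_vector_mul_bounded_linear)
  then obtain \<epsilon> where \<epsilon>: "\<epsilon> > 0" "\<And>e. norm e < \<epsilon> \<Longrightarrow> N e \<in> L \<Longrightarrow> N e = 0"
    by (metis bounded_linear_lattice_values_near_0)
  show ?thesis
  proof (rule that[OF \<epsilon>(1)])
    fix x w l e
    assume x: "x \<in> X" and w: "w \<in> range ((*v) P)" and l: "l \<in> L" and e: "norm e < \<epsilon>"
      and x_eq: "x = w + l + e"
    obtain y where y: "w = P *v y" using w by blast
    have "N e = N x - N l" using x_eq N_add N_range y by simp
    moreover have "N x - N l \<in> L"
      using lattice_diff X_lattice[OF x] N_lattice[OF l] by (simp add: N_def)
    ultimately have "N e = 0" using \<epsilon>(2) e by metis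
    then have "P *v e = e" using m by (simp add: N_def)
    then have "w + e = P *v (y + e)" using y by (simp add: matrix_vector_right_distrib)
    moreover have "proj L x = proj L (w + e)" using x_eq l by (simp add: proj_eq_iff)
    ultimately show "proj L x \<in> proj L ` range ((*v) P)" by simp
  qed
qed

lemma openin_proj_image_near:
  assumes "W \<subseteq> X" "\<epsilon> > 0"
    and near: "\<And>x w l e. x \<in> X \<Longrightarrow> w \<in> W \<Longrightarrow> l \<in> L \<Longrightarrow> norm e < \<epsilon> \<Longrightarrow> x = w + l + e \<Longrightarrow>
      proj L x \<in> proj L ` W"
  shows "openin (subtopology (torus_top L) (proj L ` X)) (proj L ` W)"
proof -
  define U where "U = proj L ` (\<Union>w\<in>W. ball w \<epsilon>)"
  have "proj L ` W = U \<inter> proj L ` X"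
  proof (intro equalityI subsetI)
    fix z assume "z \<in> proj L ` W"
    then obtain w where w: "w \<in> W" "z = proj L w" by blast
    have "w \<in> (\<Union>w\<in>W. ball w \<epsilon>)" by (rule UN_I[OF w(1)]) (simp add: assms(2))
    then show "z \<in> U \<inter> proj L ` X" unfolding U_def using w assms(1) by blast
  next
    fix z assume "z \<in> U \<inter> proj L ` X"
    then obtain x a w where z: "x \<in> X" "z = proj L x" "w \<in> W" "dist w a < \<epsilon>" "z = proj L a"
      unfolding U_def by auto
    have "x - a \<in> L" using z(2,5) proj_eq_iff by metis
    moreover have "norm (a - w) < \<epsilon>" using z(4) by (simp add: dist_norm norm_minus_commute)
    ultimately show "z \<in> proj L ` W" using near[of x w "x - a" "a - w"] z(1-3) by simp
  qed
  moreover have "openin (torus_top L) U"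
    unfolding U_def by (intro openin_proj_image open_UN ballI open_ball)
  ultimately show ?thesis unfolding openin_subtopology by blast
qed

lemma closedin_proj_image_near:
  assumes "W \<subseteq> X" "\<epsilon> > 0"
    and near: "\<And>x w l e. x \<in> X \<Longrightarrow> w \<in> W \<Longrightarrow> l \<in> L \<Longrightarrow> norm e < \<epsilon> \<Longrightarrow> x = w + l + e \<Longrightarrow>
      proj L x \<in> proj L ` W"
  shows "closedin (subtopology (torus_top L) (proj L ` X)) (proj L ` W)"
proof -
  define V where "V = proj L ` (\<Union>x\<in>{x \<in> X. proj L x \<notin> proj L ` W}. ball x \<epsilon>)"
  have "proj L ` X - proj L ` W = V \<inter> proj L ` X"
  proof (intro equalityI subsetI)
    fix z assume "z \<in> proj L ` X - proj L ` W"
    then obtain x where x: "x \<in> X" "proj L x \<notin> proj L ` W" "z = proj L x" by blast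
    have "x \<in> (\<Union>x\<in>{x \<in> X. proj L x \<notin> proj L ` W}. ball x \<epsilon>)"
      by (rule UN_I[of x]) (simp_all add: x assms(2))
    then show "z \<in> V \<inter> proj L ` X" unfolding V_def using x by blast
  next
    fix z assume z_VX: "z \<in> V \<inter> proj L ` X"
    then obtain x v where z: "x \<in> X" "proj L x \<notin> proj L ` W" "dist x v < \<epsilon>" "z = proj L v"
      unfolding V_def by auto
    have "z \<notin> proj L ` W"
    proof
      assume "z \<in> proj L ` W"
      then obtain w where "w \<in> W" "v - w \<in> L" using z(4) proj_eq_iff by auto
      moreover have "norm (x - v) < \<epsilon>" using z(3) by (simp add: dist_norm)
      ultimately show False using near[of x w "v - w" "x - v"] z(1,2) by simp
    qed
    then show "z \<in> proj L ` X - proj L ` W" using z_VX by blast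
  qed
  moreover have "openin (torus_top L) V"
    unfolding V_def by (intro openin_proj_image open_UN ballI open_ball)
  ultimately have "openin (subtopology (torus_top L) (proj L ` X)) (proj L ` X - proj L ` W)"
    unfolding openin_subtopology by blast
  moreover have "topspace (subtopology (torus_top L) (proj L ` X)) = proj L ` X"
    by (auto simp: topspace_torus_top)
  ultimately show ?thesis
    unfolding closedin_def using assms(1) by auto
qed

lemma connected_component_of_proj_range:
  fixes P :: "complex ^ 'n ^ 'n" and m :: nat
  assumes "P ** P = P" "m > 0"
    and "\<And>l. l \<in> L \<Longrightarrow> of_nat m *\<^sub>R (P *v l) \<in> L"
    and range_P: "range ((*v) P) \<subseteq> X"
    and "\<And>x. x \<in> X \<Longrightarrow> of_nat m *\<^sub>R (x - P *v x) \<in> L"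
  shows "connected_component_of_set (subtopology (torus_top L) (proj L ` X)) (proj L 0) =
    proj L ` range ((*v) P)"
proof (rule connected_component_of_eq_clopen)
  obtain \<epsilon> where "\<epsilon> > 0"
    and near: "\<And>x w l e. x \<in> X \<Longrightarrow> w \<in> range ((*v) P) \<Longrightarrow> l \<in> L \<Longrightarrow> norm e < \<epsilon> \<Longrightarrow>
      x = w + l + e \<Longrightarrow> proj L x \<in> proj L ` range ((*v) P)"
    using idempotent_lattice_gap[OF assms(1,2,3,5)] by metis
  show "openin (subtopology (torus_top L) (proj L ` X)) (proj L ` range ((*v) P))"
    by (rule openin_proj_image_near[OF range_P \<open>\<epsilon> > 0\<close> near])
  show "closedin (subtopology (torus_top L) (proj L ` X)) (proj L ` range ((*v) P))"
    by (rule closedin_proj_image_near[OF range_P \<open>\<epsilon> > 0\<close> near])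
  have "connected (range ((*v) P))"
    by (intro connected_linear_image convex_connected) simp_all
  then have "connectedin (torus_top L) (proj L ` range ((*v) P))"
    by (intro connectedin_continuous_map_image[OF continuous_map_proj]) simp
  with range_P show "connectedin (subtopology (torus_top L) (proj L ` X)) (proj L ` range ((*v) P))"
    unfolding connectedin_subtopology by blast
  show "proj L 0 \<in> proj L ` range ((*v) P)"
    by (metis matrix_vector_mult_0_right rangeI image_eqI)
qed

end

section \<open>The action of S4 on the torus\<close>

locale S4_torus = full_lattice L + S4_rep \<rho>
  for L :: "(complex ^ 'n) set" and \<rho> :: "(nat \<Rightarrow> nat) \<Rightarrow> complex ^ 'n ^ 'n" +
  assumes rep_lattice: "g \<in> S4 \<Longrightarrow> l \<in> L \<Longrightarrow> \<rho> g *v l \<in> L"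
begin

lemma grp_elt_lattice:
  assumes "\<And>g. g \<in> S4 \<Longrightarrow> c g \<in> \<int>" "l \<in> L"
  shows "grp_elt \<rho> c *v l \<in> L"
proof -
  have "grp_elt \<rho> c *v l = (\<Sum>g\<in>S4. c g *\<^sub>R (\<rho> g *v l))"
    unfolding grp_elt_def sum_matrix_vector_mult by (simp add: scaleR_matrix_vector_mult)
  also have "\<dots> \<in> L"
  proof (rule lattice_sum[OF finite_S4])
    fix g assume "g \<in> S4"
    moreover obtain z where "c g = of_int z" using assms(1)[OF \<open>g \<in> S4\<close>] Ints_cases by metis
    ultimately show "c g *\<^sub>R (\<rho> g *v l) \<in> L"
      using lattice_of_int_scaleR rep_lattice assms(2) by simp
  qed
  finally show ?thesis .
qed

lemma complement_lattice:
  assumes "l \<in> L"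
  shows "24 *\<^sub>R ((pK \<rho> H_grp - pK \<rho> S4) *v l) \<in> L"
proof -
  have "24 *\<^sub>R (pK \<rho> H_grp - pK \<rho> S4) = grp_elt \<rho> (\<lambda>g. (if g \<in> H_grp then 4 else 0) - 1)"
    unfolding pK_def card_H_grp card_S4 grp_elt_diff grp_elt_scaleR by (rule grp_elt_cong) simp
  then have "24 *\<^sub>R ((pK \<rho> H_grp - pK \<rho> S4) *v l) =
      grp_elt \<rho> (\<lambda>g. (if g \<in> H_grp then 4 else 0) - 1) *v l"
    by (simp only: scaleR_matrix_vector_mult[symmetric])
  also have "\<dots> \<in> L"
    by (rule grp_elt_lattice[OF _ assms]) simp
  finally show ?thesis .
qed

lemma ImQ_complement: "ImQ L (pK \<rho> H_grp - pK \<rho> S4) = proj L ` range ((*v) (pK \<rho> H_grp - pK \<rho> S4))"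
  using complement_lattice
  by (intro ImQ_eq_proj_range[of 24]) (simp_all add: is_endo_def scaleR_matrix_vector_mult)

lemma connected_component_q2_minus_set:
  "connected_component_of_set (subtopology (torus_top L) (q2_minus_set L \<rho>)) (proj L 0) =
    proj L ` range ((*v) (pK \<rho> H_grp - pK \<rho> S4))"
proof -
  define P where "P = pK \<rho> H_grp - pK \<rho> S4"
  define X where "X = {x. x \<in> range ((*v) (pK \<rho> H_grp)) \<and> q2 \<rho> *v x + x \<in> L}"
  have q2_X: "q2 \<rho> *v x + x = 4 *\<^sub>R (pK \<rho> S4 *v x)" and P_X: "x - P *v x = pK \<rho> S4 *v x"
    if "x \<in> range ((*v) (pK \<rho> H_grp))" for x
  proof -
    have "pK \<rho> H_grp *v x = x"
      using that by (auto simp: matrix_vector_mul_assoc pK_H_idem)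
    then show "q2 \<rho> *v x + x = 4 *\<^sub>R (pK \<rho> S4 *v x)" "x - P *v x = pK \<rho> S4 *v x"
      by (simp_all add: q2_eq P_def matrix_vector_mult_diff_rdistrib scaleR_matrix_vector_mult)
  qed
  have "range ((*v) P) \<subseteq> X"
  proof
    fix x assume "x \<in> range ((*v) P)"
    then obtain y where y: "x = P *v y" by blast
    then have "x = pK \<rho> H_grp *v x"
      by (simp add: P_def matrix_vector_mul_assoc pK_H_mult_complement)
    moreover have "pK \<rho> S4 *v x = 0"
      using y by (simp add: P_def matrix_vector_mul_assoc pK_S4_mult_complement)
    ultimately show "x \<in> X"
      unfolding X_def using q2_X[of x] lattice_zero by (metis (mono_tags) mem_Collect_eq rangeI scale_zero_right)
  qed
  moreover have "of_nat 24 *\<^sub>R (x - P *v x) \<in> L" if "x \<in> X" for x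
  proof -
    have "of_nat 24 *\<^sub>R (x - P *v x) = of_nat 6 *\<^sub>R (q2 \<rho> *v x + x)"
      using that by (simp add: X_def q2_X P_X)
    then show ?thesis using that lattice_of_nat_scaleR[of "q2 \<rho> *v x + x" 6] by (simp add: X_def)
  qed
  moreover have "q2_minus_set L \<rho> = proj L ` X"
    unfolding q2_minus_set_def X_def by auto
  ultimately show ?thesis
    using connected_component_of_proj_range[of P 24 X] complement_idem complement_lattice
    unfolding P_def by simp
qed

end

theorem mainTheorem11:
  fixes L :: "(complex ^ 'n) set" and \<rho> :: "(nat \<Rightarrow> nat) \<Rightarrow> complex ^ 'n ^ 'n"
  assumes "abelian_variety_lattice L"
    and "S4_action L \<rho>"
  shows "ImQ L (pK \<rho> H_grp ** eV \<rho>) =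
           connected_component_of_set (subtopology (torus_top L) (q2_minus_set L \<rho>)) (proj L 0)
       \<and> connected_component_of_set (subtopology (torus_top L) (q2_minus_set L \<rho>)) (proj L 0) =
           ImQ L (pK \<rho> H_grp - pK \<rho> S4)"
proof -
  interpret S4_torus L \<rho>
    using assms unfolding abelian_variety_lattice_def S4_action_def by unfold_locales auto
  show ?thesis
    using pK_H_mult_eV ImQ_complement connected_component_q2_minus_set by simp
qed

end
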